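(* Let $\mathcal H$ be a real Hilbert space, $A:\mathcal H\rightrightarrows\mathcal H$ a maximal monotone operator, $\Phi:\mathcal H\to\mathbb R$ and $\Psi_1:\mathcal H\to\mathbb R$ convex differentiable functions, and $\Psi_2:\mathcal H\to\mathbb R\cup\{+\infty\}$ a proper lower-semicontinuous convex function, with $\min\Psi_1=\min\Psi_2=0$ and $C=\operatorname{Argmin}\Psi_1\cap\operatorname{Argmin}\Psi_2\neq\emptyset$. Let $(\lambda_n)_{n\ge1}$ and $(\beta_n)_{n\ge 1}$ be sequences of positive numbers. Assume: (i) $\mathbf T=A+\nabla\Phi+N_C$ is maximal monotone and $S=\mathbf T^{-1}(0)\neq\emptyset$; (ii) $\nabla\Phi$ is $L_\Phi$-Lipschitz-continuous and $\nabla\Psi_1$ is $L_{\Psi_1}$-Lipschitz-continuous; (iii) for each $z\in N_C(\mathcal H)$, $\sum_{n=1}^\infty\lambda_n\beta_n\left[(\Psi_1+\Psi_2)^*\left(\frac{z}{\beta_n}\right)-\sigma_C\left(\frac{z}{\beta_n}\right)\right]<\infty$; (iv) $\sum_{n=1}^\infty\lambda_n=+\infty$, $\sum_{n=1}^\infty L_\Phi\lambda_n^2<+\infty$, and $\limsup_{n\to\infty}(L_{\Psi_1}\lambda_n\beta_n)<2$. If the operator $A$ is strongly monotone, or if the function $\Phi$ is strongly convex, then every sequence $(x_n)$ generated by the splitting forward-backward penalty algorithm (SFBP) converges strongly, as $n\to\infty$, to the unique $u\in S$.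
   Context: $N_C$ is the (outward) normal cone operator of the closed convex set $C$: $N_C(x)=\{x^*\in\mathcal H:\langle x^*,c-x\rangle\le0\ \forall c\in C\}$ if $x\in C$ and $N_C(x)=\emptyset$ otherwise; $N_C(\mathcal H)=\bigcup_{x\in\mathcal H}N_C(x)$ is its range. $\sigma_C(x^* )=\sup_{c\in C}\langle x^*,c\rangle$ is the support function of $C$. $F^*(x^* )=\sup_{y\in\mathcal H}\{\langle y,x^*\rangle-F(y)\}$ is the Fenchel conjugate of $F$. The case $L_\Phi=0$ (respectively $L_{\Psi_1}=0$) is allowed when $\Phi$ is affine (respectively $\Psi_1\equiv0$). $A$ is strongly monotone if there is $\alpha>0$ such that $\langle x^*-y^*,x-y\rangle\ge\alpha\|x-y\|^2$ whenever $x^*\in Ax$ and $y^*\in Ay$. $\Phi$ is strongly convex if $\nabla\Phi$ is strongly monotone. A sequence $(x_n)$ is generated by (SFBP) if $x_1\in\mathcal H$ and, for all $n\ge1$, $$x_{n+1}=(I+\lambda_nA+\lambda_n\beta_n\partial\Psi_2)^{-1}\big(x_n-\lambda_n\nabla\Phi(x_n)-\lambda_n\beta_n\nabla\Psi_1(x_n)\big),$$ that is, $$\frac{x_n-x_{n+1}}{\lambda_n}-\nabla\Phi(x_n)-\beta_n\nabla\Psi_1(x_n)\in Ax_{n+1}+\beta_n\partial\Psi_2(x_{n+1}).$$ *)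

theory Defs
  imports "HOL-Analysis.Analysis"
begin

text \<open>A set-valued operator on a space is a function into its power set. Sums of values are
  Minkowski sums (\<^theory>\<open>HOL-Library.Set_Algebras\<close>).\<close>

definition monotone_op :: "('a::real_inner \<Rightarrow> 'a set) \<Rightarrow> bool" where
  "monotone_op A \<longleftrightarrow> (\<forall>x y. \<forall>x'\<in>A x. \<forall>y'\<in>A y. inner (x' - y') (x - y) \<ge> 0)"

definition maximal_monotone :: "('a::real_inner \<Rightarrow> 'a set) \<Rightarrow> bool" where
  "maximal_monotone A \<longleftrightarrow> monotone_op A \<and>
     (\<forall>B. monotone_op B \<and> (\<forall>x. A x \<subseteq> B x) \<longrightarrow> B = A)"

definition strongly_monotone :: "('a::real_inner \<Rightarrow> 'a set) \<Rightarrow> bool" where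
  "strongly_monotone A \<longleftrightarrow> (\<exists>\<alpha>>0. \<forall>x y. \<forall>x'\<in>A x. \<forall>y'\<in>A y.
     inner (x' - y') (x - y) \<ge> \<alpha> * (norm (x - y))\<^sup>2)"

definition inv_op :: "('a \<Rightarrow> 'a set) \<Rightarrow> 'a \<Rightarrow> 'a set" where
  "inv_op A y = {x. y \<in> A x}"

definition normal_cone :: "'a::real_inner set \<Rightarrow> 'a \<Rightarrow> 'a set" where
  "normal_cone C x = (if x \<in> C then {x'. \<forall>c\<in>C. inner x' (c - x) \<le> 0} else {})"

definition support_fun :: "'a::real_inner set \<Rightarrow> 'a \<Rightarrow> ereal" where
  "support_fun C x' = (SUP c\<in>C. ereal (inner x' c))"

definition argmin_set :: "('a \<Rightarrow> 'b::ord) \<Rightarrow> 'a set" where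
  "argmin_set f = {x. is_arg_min f (\<lambda>_. True) x}"

definition has_minimum :: "('a \<Rightarrow> 'b::ord) \<Rightarrow> 'b \<Rightarrow> bool" where
  "has_minimum f m \<longleftrightarrow> (\<exists>x. f x = m) \<and> (\<forall>x. m \<le> f x)"

definition proper_fun :: "('a \<Rightarrow> ereal) \<Rightarrow> bool" where
  "proper_fun F \<longleftrightarrow> (\<forall>x. F x \<noteq> -\<infinity>) \<and> (\<exists>x. F x \<noteq> \<infinity>)"

definition lsc_fun :: "('a::topological_space \<Rightarrow> ereal) \<Rightarrow> bool" where
  "lsc_fun F \<longleftrightarrow> (\<forall>x. F x \<le> Liminf (at x) F)"

text \<open>Only meant for functions that never take the value \<open>-\<infinity>\<close>.\<close>

definition convex_fun :: "('a::real_vector \<Rightarrow> ereal) \<Rightarrow> bool" where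
  "convex_fun F \<longleftrightarrow> (\<forall>x y. \<forall>t::real. 0 < t \<and> t < 1 \<longrightarrow>
     F ((1 - t) *\<^sub>R x + t *\<^sub>R y) \<le> ereal (1 - t) * F x + ereal t * F y)"

text \<open>For proper \<open>F\<close> the subdifferential is empty wherever \<open>F\<close> is infinite.\<close>

definition subdifferential :: "('a::real_inner \<Rightarrow> ereal) \<Rightarrow> 'a \<Rightarrow> 'a set" where
  "subdifferential F x = {x'. \<forall>y. F y \<ge> F x + ereal (inner x' (y - x))}"

definition fenchel_conjugate :: "('a::real_inner \<Rightarrow> ereal) \<Rightarrow> 'a \<Rightarrow> ereal" where
  "fenchel_conjugate F x' = (SUP y. ereal (inner y x') - F y)"

text \<open>The arguments \<open>gPhi\<close> and \<open>gPsi1\<close> are the gradients of \<open>\<Phi>\<close> and \<open>\<Psi>\<^sub>1\<close>. All sequences start at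
  index 1; the values at 0 are irrelevant. When \<open>A\<close> is monotone the resolvent below has at most
  one value, so membership expresses equality.\<close>

definition sfbp_sequence ::
  "('a::real_inner \<Rightarrow> 'a set) \<Rightarrow> ('a \<Rightarrow> 'a) \<Rightarrow> ('a \<Rightarrow> 'a) \<Rightarrow> ('a \<Rightarrow> ereal) \<Rightarrow>
   (nat \<Rightarrow> real) \<Rightarrow> (nat \<Rightarrow> real) \<Rightarrow> (nat \<Rightarrow> 'a) \<Rightarrow> bool" where
  "sfbp_sequence A gPhi gPsi1 Psi2 lam beta x \<longleftrightarrow> (\<forall>n\<ge>1.
     x (Suc n) \<in> inv_op
       (\<lambda>y. {y} + scaleR (lam n) ` A y + scaleR (lam n * beta n) ` subdifferential Psi2 y)
       (x n - lam n *\<^sub>R gPhi (x n) - (lam n * beta n) *\<^sub>R gPsi1 (x n)))"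

lemma sfbp_sequence_iff:
  assumes "\<And>n. n \<ge> 1 \<Longrightarrow> lam n > 0"
  shows "sfbp_sequence A gPhi gPsi1 Psi2 lam beta x \<longleftrightarrow> (\<forall>n\<ge>1.
     (x n - x (Suc n)) /\<^sub>R lam n - gPhi (x n) - beta n *\<^sub>R gPsi1 (x n)
       \<in> A (x (Suc n)) + scaleR (beta n) ` subdifferential Psi2 (x (Suc n)))"
proof -
  have eq: "p - l *\<^sub>R g - (l * b) *\<^sub>R h = q + l *\<^sub>R a + (l * b) *\<^sub>R s \<longleftrightarrow>
      (p - q) /\<^sub>R l - g - b *\<^sub>R h = a + b *\<^sub>R s" if "l > 0" for l b :: real and p q g h a s :: 'a
  proof -
    have "p - l *\<^sub>R g - (l * b) *\<^sub>R h = q + l *\<^sub>R a + (l * b) *\<^sub>R s \<longleftrightarrow>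
        l *\<^sub>R ((p - q) /\<^sub>R l - g - b *\<^sub>R h) = l *\<^sub>R (a + b *\<^sub>R s)"
      using that by (simp add: algebra_simps)
    then show ?thesis using that by simp
  qed
  have "p \<in> {q} + scaleR l ` V + scaleR (l * b) ` W \<longleftrightarrow>
      (\<exists>a\<in>V. \<exists>s\<in>W. p = q + l *\<^sub>R a + (l * b) *\<^sub>R s)" for p q :: 'a and l b V W
    by (auto simp: set_plus_def)
  moreover have "p \<in> V + scaleR b ` W \<longleftrightarrow> (\<exists>a\<in>V. \<exists>s\<in>W. p = a + b *\<^sub>R s)"
    for p :: 'a and b V W
    by (auto simp: set_plus_def)
  ultimately show ?thesis
    using assms by (simp add: sfbp_sequence_def inv_op_def eq)
qed

end

theory Submission
  imports Defs
begin

text \<open>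
  The proof measures the distance to a solution \<open>u\<close>. Write \<open>0 = v + \<nabla>\<Phi>(u) + p\<close> with \<open>v \<in> A u\<close>
  and a multiplier \<open>p \<in> N\<^sub>C(u)\<close>. Expanding \<open>\<parallel>x\<^sub>n - u\<parallel>\<^sup>2\<close> around \<open>x\<^sub>n\<^sub>+\<^sub>1\<close> and inserting the inclusion
  that defines the step, one obtains, for \<open>n\<close> large,
  \<open>\<parallel>x\<^sub>n\<^sub>+\<^sub>1 - u\<parallel>\<^sup>2 + 2 \<alpha> \<lambda>\<^sub>n m\<^sub>n \<le> \<parallel>x\<^sub>n - u\<parallel>\<^sup>2 + \<epsilon>\<^sub>n\<close>
  with \<open>m\<^sub>n = min {\<parallel>x\<^sub>n - u\<parallel>\<^sup>2, \<parallel>x\<^sub>n\<^sub>+\<^sub>1 - u\<parallel>\<^sup>2}\<close> and \<open>\<Sum> \<epsilon>\<^sub>n < \<infinity>\<close> (lemma \<open>energy_decrease\<close>).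
  Therefore \<open>\<parallel>x\<^sub>n - u\<parallel>\<^sup>2\<close> converges and \<open>\<Sum> \<lambda>\<^sub>n m\<^sub>n < \<infinity>\<close>. Since \<open>\<Sum> \<lambda>\<^sub>n = \<infinity>\<close>, the common limit of
  \<open>m\<^sub>n\<close> and \<open>\<parallel>x\<^sub>n - u\<parallel>\<^sup>2\<close> is zero.

  Three ingredients give the inequality. First, the gradients are evaluated at \<open>x\<^sub>n\<close> but paired
  with \<open>x\<^sub>n\<^sub>+\<^sub>1 - u\<close>; the error is a multiple of \<open>\<parallel>x\<^sub>n\<^sub>+\<^sub>1 - x\<^sub>n\<parallel>\<^sup>2\<close> because Lipschitz gradients of
  convex functions are cocoercive (\<open>lipschitz_gradient_cocoercive\<close>), and the constant is small
  enough to be absorbed by the \<open>- \<parallel>x\<^sub>n\<^sub>+\<^sub>1 - x\<^sub>n\<parallel>\<^sup>2\<close> of the expansion because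
  \<open>limsup L \<lambda>\<^sub>n \<beta>\<^sub>n < 2\<close> for the Lipschitz constant \<open>L\<close> of \<open>\<nabla>\<Psi>\<^sub>1\<close> and \<open>L\<^sub>\<Phi> \<lambda>\<^sub>n \<rightarrow> 0\<close>. Second, whichever of \<open>A\<close> and \<open>\<nabla>\<Phi>\<close> is strongly
  monotone contributes \<open>\<alpha> m\<^sub>n\<close> (\<open>strong_monotonicity_forward_backward\<close>): the implicit \<open>A\<close> sees
  \<open>x\<^sub>n\<^sub>+\<^sub>1\<close> and the explicit \<open>\<nabla>\<Phi>\<close> sees \<open>x\<^sub>n\<close>, hence the minimum.

  Third, the slack in \<open>limsup < 2\<close> allows one to retain a fraction \<open>\<eta>\<close> of the penalty
  \<open>\<beta>\<^sub>n (\<Psi>\<^sub>1 + \<Psi>\<^sub>2)(x\<^sub>n\<^sub>+\<^sub>1)\<close> (\<open>penalty_forward_step\<close>). What remains of the multiplier is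
  \<open>\<langle>p, x\<^sub>n\<^sub>+\<^sub>1 - u\<rangle> - \<eta> \<beta>\<^sub>n (\<Psi>\<^sub>1 + \<Psi>\<^sub>2)(x\<^sub>n\<^sub>+\<^sub>1)\<close>, which for \<open>z = p/\<eta> \<in> N\<^sub>C(u)\<close> is at most
  \<open>\<eta> \<beta>\<^sub>n\<close> times the gap \<open>(\<Psi>\<^sub>1 + \<Psi>\<^sub>2)\<^sup>*(z/\<beta>\<^sub>n) - \<sigma>\<^sub>C(z/\<beta>\<^sub>n)\<close>; multiplied by \<open>\<lambda>\<^sub>n\<close> this is
  summable by hypothesis (\<open>conjugate_gap_errors\<close>).
\<close>

section \<open>Convex functions with Lipschitz gradient\<close>

lemma gderiv_along_line:
  assumes "\<And>x. GDERIV f x :> g x"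
  shows "((\<lambda>t. f (x + t *\<^sub>R d)) has_real_derivative inner (g (x + t *\<^sub>R d)) d) (at t within S)"
proof -
  have line: "((\<lambda>t. x + t *\<^sub>R d) has_derivative (\<lambda>h. h *\<^sub>R d)) (at t within S)"
    by (auto intro!: derivative_eq_intros)
  have outer: "(f has_derivative (\<lambda>h. inner h (g (x + t *\<^sub>R d)))) (at (x + t *\<^sub>R d))"
    using assms by (simp add: gderiv_def)
  show ?thesis
    using has_derivative_compose[OF line outer] unfolding has_field_derivative_def
    by (rule has_derivative_eq_rhs) (simp add: fun_eq_iff inner_commute mult.commute)
qed

lemma convex_above_tangent:
  assumes "convex_on UNIV f" and grad: "\<And>x. GDERIV f x :> g x"
  shows "f y \<ge> f x + inner (g x) (y - x)"
proof -
  let ?\<phi> = "\<lambda>t::real. f (x + t *\<^sub>R (y - x))"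
  have "convex_on UNIV ?\<phi>"
  proof (rule convex_onI)
    fix t a b :: real
    assume t: "0 < t" "t < 1"
    have "x + ((1 - t) *\<^sub>R a + t *\<^sub>R b) *\<^sub>R (y - x)
        = (1 - t) *\<^sub>R (x + a *\<^sub>R (y - x)) + t *\<^sub>R (x + b *\<^sub>R (y - x))"
      by (simp add: algebra_simps)
    then show "?\<phi> ((1 - t) *\<^sub>R a + t *\<^sub>R b) \<le> (1 - t) * ?\<phi> a + t * ?\<phi> b"
      using convex_onD[OF assms(1), of t "x + a *\<^sub>R (y - x)" "x + b *\<^sub>R (y - x)"] t by simp
  qed simp
  then have "?\<phi> 1 - ?\<phi> 0 \<ge> inner (g x) (y - x) * (1 - 0)"
    using gderiv_along_line[OF grad, of x "y - x" 0 UNIV]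
    by (intro convex_on_imp_above_tangent[where A = UNIV]) auto
  then show ?thesis by simp
qed

lemma lipschitz_gradient_quadratic_upper_bound:
  assumes grad: "\<And>x. GDERIV f x :> g x" and lip: "L-lipschitz_on UNIV g"
  shows "f y \<le> f x + inner (g x) (y - x) + L / 2 * (norm (y - x))\<^sup>2"
proof -
  define d where "d = y - x"
  define \<phi> where
    "\<phi> t = f (x + t *\<^sub>R d) - t * inner (g x) d - L / 2 * (norm d)\<^sup>2 * t\<^sup>2" for t
  have "\<phi> 1 \<le> \<phi> 0"
  proof (rule DERIV_nonpos_imp_nonincreasing, simp)
    fix t :: real
    assume t: "0 \<le> t" "t \<le> 1"
    let ?D = "inner (g (x + t *\<^sub>R d)) d - inner (g x) d - L / 2 * (norm d)\<^sup>2 * (2 * t)"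
    have "(\<phi> has_real_derivative ?D) (at t)"
      unfolding \<phi>_def
      by (auto intro!: derivative_eq_intros gderiv_along_line[OF grad])
    moreover have "?D \<le> 0"
    proof -
      have "norm (g (x + t *\<^sub>R d) - g x) \<le> L * (t * norm d)"
        using lipschitz_onD[OF lip, of "x + t *\<^sub>R d" x] t by (simp add: dist_norm)
      then have "norm (g (x + t *\<^sub>R d) - g x) * norm d \<le> L * (t * norm d) * norm d"
        by (rule mult_right_mono) simp
      with norm_cauchy_schwarz[of "g (x + t *\<^sub>R d) - g x" d] show ?thesis
        by (simp add: inner_diff_left power2_eq_square mult_ac)
    qed
    ultimately show "\<exists>D. (\<phi> has_real_derivative D) (at t) \<and> D \<le> 0" by blast
  qed
  then show ?thesis by (simp add: \<phi>_def d_def)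
qed

text \<open>This is the Baillon--Haddad theorem. Comparing the tangent at \<open>x\<close> with the quadratic upper
  bound at \<open>y\<close> in the point \<open>y + (g x - g y)/L\<close>, where their difference is extremal, shows that the convexity gap \<open>f y - f x - \<langle>g x, y - x\<rangle>\<close> is at least
  \<open>\<parallel>g x - g y\<parallel>\<^sup>2 / (2L)\<close>; adding the same bound with \<open>x\<close> and \<open>y\<close> exchanged eliminates \<open>f\<close>.
  The product form also covers \<open>L = 0\<close>.\<close>

lemma lipschitz_gradient_cocoercive:
  assumes conv: "convex_on UNIV f" and grad: "\<And>x. GDERIV f x :> g x"
    and lip: "L-lipschitz_on UNIV g"
  shows "(norm (g x - g y))\<^sup>2 \<le> L * inner (g x - g y) (x - y)"
proof (cases "L = 0")
  case True
  then show ?thesis using lipschitz_onD[OF lip, of x y] by simp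
next
  case False
  then have L: "L > 0" using lipschitz_on_nonneg[OF lip] by simp
  have half: "(norm (g x - g y))\<^sup>2 / (2 * L) \<le> f y - f x - inner (g x) (y - x)" for x y
  proof -
    define D where "D = g x - g y"
    define w where "w = y + (1 / L) *\<^sub>R D"
    have tangent: "f x + inner (g x) (w - x) \<le> f w"
      by (rule convex_above_tangent[OF conv grad])
    have quadratic: "f w \<le> f y + inner (g y) (w - y) + L / 2 * (norm (w - y))\<^sup>2"
      by (rule lipschitz_gradient_quadratic_upper_bound[OF grad lip])
    have wy: "w - y = (1 / L) *\<^sub>R D" by (simp add: w_def)
    have "inner (g x) (w - x) - inner (g y) (w - y) = inner (g x) (y - x) + inner D (w - y)"
      by (simp add: D_def inner_diff_left inner_diff_right)
    also have "inner D (w - y) = (norm D)\<^sup>2 / L"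
      by (simp add: wy power2_norm_eq_inner)
    also have "\<dots> = 2 * ((norm D)\<^sup>2 / (2 * L))" by simp
    finally have slopes: "inner (g x) (w - x) - inner (g y) (w - y)
        = inner (g x) (y - x) + 2 * ((norm D)\<^sup>2 / (2 * L))" .
    have "L / 2 * (norm (w - y))\<^sup>2 = (norm D)\<^sup>2 / (2 * L)"
      using L by (simp add: wy power_divide power2_eq_square)
    with tangent quadratic slopes show ?thesis
      unfolding D_def by linarith
  qed
  have "(norm (g x - g y))\<^sup>2 / L \<le> inner (g x - g y) (x - y)"
  proof -
    have "(norm (g x - g y))\<^sup>2 / L
        = (norm (g x - g y))\<^sup>2 / (2 * L) + (norm (g y - g x))\<^sup>2 / (2 * L)"
      by (simp add: norm_minus_commute)
    also have "\<dots> \<le> - inner (g x) (y - x) - inner (g y) (x - y)"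
      using half[of x y] half[of y x] by simp
    also have "\<dots> = inner (g x - g y) (x - y)" by (simp add: inner_diff_left inner_diff_right)
    finally show ?thesis .
  qed
  then show ?thesis using L by (simp add: field_simps)
qed

section \<open>Forward steps\<close>

text \<open>Here \<open>D\<close> is the variation of a cocoercive operator between a reference point and the
  current point, \<open>w\<close> the displacement from the reference point and \<open>d\<close> the next step. The
  cross term \<open>\<langle>D, d\<rangle>\<close> is absorbed by completing the square in \<open>D/\<surd>L + (\<surd>L/2) d\<close>; the constant
  \<open>L/4\<close> is the one that makes step sizes up to \<open>2/L\<close> admissible.\<close>

lemma cocoercive_forward_step:
  fixes D w d :: "'a::real_inner"
  assumes "L \<ge> 0" and coco: "(norm D)\<^sup>2 \<le> L * inner D w"
  shows "inner D (w + d) \<ge> - (L / 4) * (norm d)\<^sup>2"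
proof (cases "L = 0")
  case True
  with coco show ?thesis by simp
next
  case False
  with assms have L: "L > 0" by simp
  have "0 \<le> (norm (D + (L / 2) *\<^sub>R d))\<^sup>2" by simp
  also have "\<dots> = (norm D)\<^sup>2 + L * inner D d + L * (L / 4) * (norm d)\<^sup>2"
    unfolding power2_norm_eq_inner
    by (simp add: inner_add_left inner_add_right inner_commute[of d D] field_simps)
  also have "\<dots> \<le> L * (inner D (w + d) + L / 4 * (norm d)\<^sup>2)"
    using coco by (simp add: inner_add_right algebra_simps)
  finally show ?thesis using L by (simp add: zero_le_mult_iff)
qed

text \<open>Half of \<open>\<langle>D, w\<rangle>\<close> is kept for strong monotonicity and the other half controls the cross
  term.\<close>

lemma strongly_monotone_forward_step:
  fixes D w d :: "'a::real_inner"
  assumes "L \<ge> 0" and "(norm D)\<^sup>2 \<le> L * inner D w" and "inner D w \<ge> \<alpha> * (norm w)\<^sup>2"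
  shows "inner D (w + d) \<ge> \<alpha> / 2 * (norm w)\<^sup>2 - L / 2 * (norm d)\<^sup>2"
proof -
  have "inner D (w + 2 *\<^sub>R d) \<ge> - (L / 4) * (norm (2 *\<^sub>R d))\<^sup>2"
    by (rule cocoercive_forward_step) (use assms in auto)
  then show ?thesis using assms(3) by (simp add: inner_add_right power_mult_distrib)
qed

text \<open>Cocoercivity alone gives the bound with \<open>\<eta> = 0\<close>, convexity and the quadratic upper bound
  alone the one with \<open>\<eta> = 1\<close>. Only the first has a constant that matches the condition
  \<open>limsup L \<lambda>\<^sub>n \<beta>\<^sub>n < 2\<close>, and only the second retains a multiple of \<open>f y\<close>, which is needed against
  the multiplier of the constraint; a convex combination with small \<open>\<eta>\<close> has both virtues.\<close>

lemma penalty_forward_step: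
  assumes conv: "convex_on UNIV f" and grad: "\<And>x. GDERIV f x :> g x"
    and lip: "L-lipschitz_on UNIV g"
    and min: "f u = 0" "\<And>x. f x \<ge> 0"
    and \<eta>: "0 \<le> \<eta>" "\<eta> \<le> 1"
  shows "inner (g x) (y - u) \<ge> \<eta> * f y - (1 + \<eta>) * (L / 4) * (norm (y - x))\<^sup>2"
proof -
  have "(\<lambda>h. inner h (g u)) = (\<lambda>h. 0)"
    using grad[of u] min by (intro has_derivative_local_min[of f]) (auto simp: gderiv_def)
  then have "inner (g u) (g u) = 0" by (rule fun_cong)
  then have gu: "g u = 0" by simp
  have "(norm (g x))\<^sup>2 \<le> L * inner (g x) (x - u)"
    using lipschitz_gradient_cocoercive[OF conv grad lip, of x u] gu by simp
  from cocoercive_forward_step[OF lipschitz_on_nonneg[OF lip] this, of "y - x"]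
  have sharp: "inner (g x) (y - u) \<ge> - (L / 4) * (norm (y - x))\<^sup>2" by simp
  have "inner (g x) (u - x) \<le> - f x"
    using convex_above_tangent[OF conv grad, of x u] min by simp
  moreover have "f y \<le> f x + inner (g x) (y - x) + L / 2 * (norm (y - x))\<^sup>2"
    by (rule lipschitz_gradient_quadratic_upper_bound[OF grad lip])
  ultimately have flat: "inner (g x) (y - u) \<ge> f y - L / 2 * (norm (y - x))\<^sup>2"
    by (simp add: inner_diff_right)
  have "\<eta> * (f y - L / 2 * (norm (y - x))\<^sup>2) + (1 - \<eta>) * (- (L / 4) * (norm (y - x))\<^sup>2)
      \<le> \<eta> * inner (g x) (y - u) + (1 - \<eta>) * inner (g x) (y - u)"
    using \<eta> by (intro add_mono mult_left_mono sharp flat) auto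
  then show ?thesis by (simp add: field_simps)
qed

section \<open>The conjugate gap\<close>

lemma support_fun_normal_cone:
  assumes "z \<in> normal_cone C u"
  shows "support_fun C z = ereal (inner z u)"
proof -
  have u: "u \<in> C" and le: "\<And>c. c \<in> C \<Longrightarrow> inner z c \<le> inner z u"
    using assms by (auto simp: normal_cone_def inner_diff_right split: if_splits)
  show ?thesis
    unfolding support_fun_def
    by (rule antisym) (auto intro!: SUP_least SUP_upper2[OF u] le)
qed

lemma normal_cone_scaleR:
  assumes "z \<in> normal_cone C u" "t \<ge> 0"
  shows "t *\<^sub>R z \<in> normal_cone C u"
  using assms by (auto simp: normal_cone_def mult_nonneg_nonpos split: if_splits)

lemma conjugate_gap_lower_bound:
  assumes "z \<in> normal_cone C u" and "F y = ereal r"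
  shows "fenchel_conjugate F z - support_fun C z \<ge> ereal (inner z (y - u) - r)"
proof -
  have "ereal (inner y z) - F y \<le> fenchel_conjugate F z"
    unfolding fenchel_conjugate_def by (rule SUP_upper) simp
  then have "ereal (inner y z - r) - ereal (inner z u) \<le> fenchel_conjugate F z - ereal (inner z u)"
    using assms(2) by (intro ereal_minus_mono) auto
  then show ?thesis
    by (simp add: support_fun_normal_cone[OF assms(1)] inner_diff_right inner_commute algebra_simps)
qed

text \<open>The point \<open>u\<close> itself shows that the gap is nonnegative, so the extended-real series
  converges only if all its terms are finite.\<close>

lemma conjugate_gap_errors:
  assumes z: "z \<in> normal_cone C u" and Fu: "F u = 0"
    and pos: "\<And>n. w n > 0" "\<And>n. \<beta> n > 0"
    and fin: "(\<Sum>n. ereal (w n) * (fenchel_conjugate F (z /\<^sub>R \<beta> n) - support_fun C (z /\<^sub>R \<beta> n))) < \<infinity>"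
  obtains e :: "nat \<Rightarrow> real" where "summable e" "\<And>n. e n \<ge> 0"
    "\<And>n y r. F y = ereal r \<Longrightarrow> w n * (inner (z /\<^sub>R \<beta> n) (y - u) - r) \<le> e n"
proof
  define G where
    "G n = ereal (w n) * (fenchel_conjugate F (z /\<^sub>R \<beta> n) - support_fun C (z /\<^sub>R \<beta> n))" for n
  have cone: "z /\<^sub>R \<beta> n \<in> normal_cone C u" for n
    using pos(2)[of n] by (intro normal_cone_scaleR z) simp
  have lower: "ereal (w n * (inner (z /\<^sub>R \<beta> n) (y - u) - r)) \<le> G n" if "F y = ereal r" for n y r
  proof -
    have "ereal (w n) * ereal (inner (z /\<^sub>R \<beta> n) (y - u) - r) \<le> G n"
      unfolding G_def using pos(1)[of n]
      by (intro ereal_mult_left_mono conjugate_gap_lower_bound[OF cone] that) simp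
    then show ?thesis by simp
  qed
  have nonneg: "0 \<le> G n" for n
    using lower[of u 0 n] Fu by (simp add: zero_ereal_def)
  have "(\<Sum>n. G n) \<noteq> \<infinity>" using fin by (simp add: G_def)
  note sum = summable_real_of_ereal[OF nonneg this] and finite = suminf_PInfty[OF nonneg this]
  show "summable (\<lambda>n. real_of_ereal (G n))" by (rule sum)
  show "real_of_ereal (G n) \<ge> 0" for n using nonneg by (rule real_of_ereal_pos)
  show "w n * (inner (z /\<^sub>R \<beta> n) (y - u) - r) \<le> real_of_ereal (G n)" if "F y = ereal r" for n y r
    using lower[OF that, of n] finite[of n] nonneg[of n] by (cases "G n") auto
qed

section \<open>Quasi-Fejer sequences\<close>

text \<open>Subtracting the partial sums of \<open>e\<close> turns \<open>a\<close> into a decreasing sequence that is bounded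
  below; telescoping the inequality bounds the partial sums of \<open>c\<close>.\<close>

lemma quasi_fejer_convergent_summable:
  fixes a c e :: "nat \<Rightarrow> real"
  assumes nonneg: "\<And>n. a n \<ge> 0" "\<And>n. c n \<ge> 0" "\<And>n. e n \<ge> 0"
    and e: "summable e" and step: "\<And>n. a (Suc n) + c n \<le> a n + e n"
  shows "convergent a" and "summable c"
proof -
  define b where "b n = a n - (\<Sum>k<n. e k)" for n
  have e_le: "(\<Sum>k<n. e k) \<le> suminf e" for n
    using nonneg(3) by (intro sum_le_suminf e) auto
  have "decseq b"
  proof (rule decseq_SucI)
    show "b (Suc n) \<le> b n" for n using step[of n] nonneg(2)[of n] by (simp add: b_def)
  qed
  moreover have "- suminf e \<le> b n" for n
    using e_le[of n] nonneg(1)[of n] by (simp add: b_def)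
  ultimately obtain l where "b \<longlonglongrightarrow> l"
    using decseq_convergent by blast
  then have "(\<lambda>n. b n + (\<Sum>k<n. e k)) \<longlonglongrightarrow> l + suminf e"
    by (intro tendsto_add summable_LIMSEQ e)
  then show "convergent a" by (auto simp: b_def convergent_def)
  have tele: "(\<Sum>k<n. c k) \<le> a 0 + (\<Sum>k<n. e k) - a n" for n
  proof (induction n)
    case (Suc n)
    then show ?case using step[of n] by simp
  qed simp
  show "summable c"
    using nonneg(2)
  proof (rule summableI_nonneg_bounded)
    fix n
    show "(\<Sum>k<n. c k) \<le> a 0 + suminf e" using tele[of n] e_le[of n] nonneg(1)[of n] by linarith
  qed
qed

text \<open>A positive limit would make \<open>w\<close> summable by comparison.\<close>

lemma limit_zero_if_weighted_summable:
  fixes w m :: "nat \<Rightarrow> real"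
  assumes "\<And>n. w n \<ge> 0" and "\<not> summable w" and "summable (\<lambda>n. w n * m n)"
    and lim: "m \<longlonglongrightarrow> l" and "l \<ge> 0"
  shows "l = 0"
proof (rule ccontr)
  assume "l \<noteq> 0"
  with \<open>l \<ge> 0\<close> have l: "l > 0" by simp
  then have "\<forall>\<^sub>F n in sequentially. m n > l / 2"
    using lim by (intro order_tendstoD) auto
  then have "\<forall>\<^sub>F n in sequentially. norm (w n) \<le> 2 / l * (w n * m n)"
  proof eventually_elim
    case (elim n)
    then have "w n * (l / 2) \<le> w n * m n" using assms(1) by (intro mult_left_mono) auto
    then show ?case using l assms(1)[of n] by (simp add: field_simps)
  qed
  then have "summable w"
    by (rule summable_comparison_test_ev) (intro summable_mult assms(3))
  with assms(2) show False by simp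
qed

section \<open>One step of the algorithm\<close>

text \<open>The operator \<open>A\<close> enters at the new point \<open>y\<close> and \<open>g\<close> at the old point \<open>x\<close>, so that strong
  monotonicity yields \<open>\<parallel>y - u\<parallel>\<^sup>2\<close> in one case and \<open>\<parallel>x - u\<parallel>\<^sup>2\<close> in the other; the minimum serves
  both. The instance \<open>x = y\<close> gives uniqueness of the solution.\<close>

lemma strong_monotonicity_forward_backward:
  assumes A: "monotone_op A"
    and conv: "convex_on UNIV f" and grad: "\<And>x. GDERIV f x :> g x"
    and lip: "L-lipschitz_on UNIV g"
    and strong: "strongly_monotone A \<or> strongly_monotone (\<lambda>x. {g x})"
  obtains \<alpha> where "\<alpha> > 0"
    "\<And>x y u a v. a \<in> A y \<Longrightarrow> v \<in> A u \<Longrightarrow>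
       inner (g x - g u) (y - u) + inner (a - v) (y - u)
         \<ge> \<alpha> * min ((norm (x - u))\<^sup>2) ((norm (y - u))\<^sup>2) - L / 2 * (norm (y - x))\<^sup>2"
proof -
  have L: "L \<ge> 0" by (rule lipschitz_on_nonneg[OF lip])
  note coco = lipschitz_gradient_cocoercive[OF conv grad lip]
  have split: "y - u = (x - u) + (y - x)" for x y u :: 'a by simp
  from strong show thesis
  proof
    assume "strongly_monotone A"
    then obtain \<alpha> where \<alpha>: "\<alpha> > 0" "\<And>y u a v. a \<in> A y \<Longrightarrow> v \<in> A u \<Longrightarrow>
        inner (a - v) (y - u) \<ge> \<alpha> * (norm (y - u))\<^sup>2"
      unfolding strongly_monotone_def by blast
    show thesis
    proof (rule that[OF \<alpha>(1)])
      fix x y u a v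
      assume av: "a \<in> A y" "v \<in> A u"
      have "inner (g x - g u) (y - u) \<ge> - (L / 4) * (norm (y - x))\<^sup>2"
        unfolding split[of y u x] by (rule cocoercive_forward_step[OF L coco])
      moreover have "L / 4 * (norm (y - x))\<^sup>2 \<le> L / 2 * (norm (y - x))\<^sup>2"
        using L by (intro mult_right_mono) auto
      moreover have "\<alpha> * min ((norm (x - u))\<^sup>2) ((norm (y - u))\<^sup>2) \<le> \<alpha> * (norm (y - u))\<^sup>2"
        using \<alpha>(1) by (intro mult_left_mono) auto
      ultimately show "inner (g x - g u) (y - u) + inner (a - v) (y - u)
          \<ge> \<alpha> * min ((norm (x - u))\<^sup>2) ((norm (y - u))\<^sup>2) - L / 2 * (norm (y - x))\<^sup>2"
        using \<alpha>(2)[OF av] by linarith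
    qed
  next
    assume "strongly_monotone (\<lambda>x. {g x})"
    then obtain \<alpha> where \<alpha>: "\<alpha> > 0"
      "\<And>x u. inner (g x - g u) (x - u) \<ge> \<alpha> * (norm (x - u))\<^sup>2"
      unfolding strongly_monotone_def by blast
    show thesis
    proof (rule that[of "\<alpha> / 2"])
      fix x y u a v
      assume av: "a \<in> A y" "v \<in> A u"
      have "inner (g x - g u) (y - u) \<ge> \<alpha> / 2 * (norm (x - u))\<^sup>2 - L / 2 * (norm (y - x))\<^sup>2"
        unfolding split[of y u x] by (rule strongly_monotone_forward_step[OF L coco \<alpha>(2)])
      moreover have "\<alpha> / 2 * min ((norm (x - u))\<^sup>2) ((norm (y - u))\<^sup>2) \<le> \<alpha> / 2 * (norm (x - u))\<^sup>2"
        using \<alpha>(1) by (intro mult_left_mono) auto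
      moreover have "inner (a - v) (y - u) \<ge> 0"
        using A av by (auto simp: monotone_op_def)
      ultimately show "inner (g x - g u) (y - u) + inner (a - v) (y - u)
          \<ge> \<alpha> / 2 * min ((norm (x - u))\<^sup>2) ((norm (y - u))\<^sup>2) - L / 2 * (norm (y - x))\<^sup>2"
        by linarith
    qed (use \<alpha> in simp)
  qed
qed

text \<open>In the application \<open>x\<close> and \<open>y\<close> are consecutive iterates, \<open>g\<close>, \<open>h\<close>, \<open>a\<close>, \<open>s\<close> are the
  values of \<open>\<nabla>\<Phi>\<close>, \<open>\<nabla>\<Psi>\<^sub>1\<close>, \<open>A\<close>, \<open>\<partial>\<Psi>\<^sub>2\<close> in the step, and \<open>v + g\<^sub>u + p = 0\<close> with
  \<open>p \<in> N\<^sub>C(u)\<close> expresses that \<open>u\<close> is a solution. All losses are multiples of \<open>\<parallel>y - x\<parallel>\<^sup>2\<close> and are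
  paid by the term of this form in the expansion of \<open>\<parallel>x - u\<parallel>\<^sup>2\<close>. The multiplier \<open>p\<close>, whose sign is
  uncontrolled at infeasible \<open>y\<close>, is paired with the retained part of the penalty; this pair is a
  Fenchel expression in the multiplier \<open>p/\<eta>\<close>.\<close>

lemma energy_decrease:
  fixes x y u g gu h a s v p :: "'a::real_inner"
  assumes step: "(x - y) /\<^sub>R l - g - b *\<^sub>R h = a + b *\<^sub>R s"
    and opt: "v + gu + p = 0"
    and pos: "l > 0" "b > 0" "\<eta> > 0"
    and main: "inner (g - gu) (y - u) + inner (a - v) (y - u) \<ge> \<alpha> * m - L / 2 * (norm (y - x))\<^sup>2"
    and pen1: "inner h (y - u) \<ge> \<eta> * P1 - (1 + \<eta>) * (L1 / 4) * (norm (y - x))\<^sup>2"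
    and pen2: "inner s (y - u) \<ge> \<eta> * P2"
    and small: "(1 + \<eta>) / 2 * (L1 * l * b) + L * l \<le> 1"
  shows "(norm (y - u))\<^sup>2 + 2 * \<alpha> * (l * m)
    \<le> (norm (x - u))\<^sup>2 + 2 * \<eta> * (l * b * (inner (p /\<^sub>R \<eta> /\<^sub>R b) (y - u) - (P1 + P2)))"
proof -
  define r where "r = (norm (y - x))\<^sup>2"
  have "x - y = l *\<^sub>R ((x - y) /\<^sub>R l)" using pos(1) by simp
  also have "(x - y) /\<^sub>R l = g + b *\<^sub>R h + a + b *\<^sub>R s"
    using step by (simp add: algebra_simps)
  finally have "inner (x - y) (y - u) = inner (l *\<^sub>R (g + b *\<^sub>R h + a + b *\<^sub>R s)) (y - u)"
    by simp
  moreover have "inner (v + gu + p) (y - u) = 0" by (simp add: opt)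
  ultimately have
    "inner (x - y) (y - u) = l * (inner (g - gu) (y - u) + inner (a - v) (y - u)
      - inner p (y - u) + b * inner h (y - u) + b * inner s (y - u))"
    by (simp add: inner_add_left inner_diff_left[of g] inner_diff_left[of a])
  also have "\<dots> \<ge> l * ((\<alpha> * m - L / 2 * r) - inner p (y - u)
      + b * (\<eta> * P1 - (1 + \<eta>) * (L1 / 4) * r) + b * (\<eta> * P2))"
    using pos main pen1 pen2 unfolding r_def
    by (intro mult_left_mono add_mono diff_mono) auto
  finally have inner_ge: "2 * inner (x - y) (y - u)
      \<ge> 2 * l * \<alpha> * m - 2 * l * inner p (y - u) + 2 * l * b * \<eta> * (P1 + P2)
        - ((1 + \<eta>) / 2 * (L1 * l * b) + L * l) * r"
    by (simp add: algebra_simps)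
  have "((1 + \<eta>) / 2 * (L1 * l * b) + L * l) * r \<le> 1 * r"
    using small by (rule mult_right_mono) (simp add: r_def)
  moreover have "(norm (x - u))\<^sup>2 = (norm ((x - y) + (y - u)))\<^sup>2" by simp
  then have "(norm (x - u))\<^sup>2 = r + (norm (y - u))\<^sup>2 + 2 * inner (x - y) (y - u)"
    unfolding r_def power2_norm_eq_inner
    by (simp only: inner_add_left inner_add_right inner_commute[of "y - u" "x - y"])
      (simp add: inner_diff_left inner_diff_right)
  moreover have "2 * \<eta> * (l * b * (inner (p /\<^sub>R \<eta> /\<^sub>R b) (y - u) - (P1 + P2)))
      = 2 * l * inner p (y - u) - 2 * l * b * \<eta> * (P1 + P2)"
    using pos by (simp add: field_simps)
  ultimately show ?thesis using inner_ge by (simp add: mult_ac)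
qed

lemma subgradient_at_zero_minimum:
  assumes s: "s \<in> subdifferential F y" and u: "F u = 0" and nonneg: "\<And>w. F w \<ge> 0"
  obtains r where "F y = ereal r" "r \<ge> 0" "inner s (y - u) \<ge> r"
proof -
  have "F y + ereal (inner s (u - y)) \<le> 0"
    using s u by (auto simp: subdifferential_def dest: spec[of _ u])
  with nonneg[of y] that show thesis
    by (cases "F y") (auto simp: inner_diff_right zero_ereal_def)
qed

section \<open>Strong convergence\<close>

lemma argmin_setD_minimum:
  fixes f :: "'a \<Rightarrow> 'b::linorder"
  assumes "has_minimum f m" "x \<in> argmin_set f"
  shows "f x = m"
proof (rule antisym)
  show "f x \<le> m"
    using assms by (auto simp: has_minimum_def argmin_set_def is_arg_min_linorder)
  show "m \<le> f x"
    using assms(1) by (simp add: has_minimum_def)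
qed

theorem theorem2:
  fixes A :: "'a::{real_inner, complete_space} \<Rightarrow> 'a set"
    and \<Phi> \<Psi>\<^sub>1 :: "'a \<Rightarrow> real"
    and gPhi gPsi1 :: "'a \<Rightarrow> 'a"
    and \<Psi>\<^sub>2 :: "'a \<Rightarrow> ereal"
    and C S :: "'a set"
    and T :: "'a \<Rightarrow> 'a set"
    and lam beta :: "nat \<Rightarrow> real"
    and L_Phi L_Psi1 :: real
  assumes A: "maximal_monotone A"
    and Phi_convex: "convex_on UNIV \<Phi>"
    and Phi_grad: "\<And>x. GDERIV \<Phi> x :> gPhi x"
    and Psi1_convex: "convex_on UNIV \<Psi>\<^sub>1"
    and Psi1_grad: "\<And>x. GDERIV \<Psi>\<^sub>1 x :> gPsi1 x"
    and Psi2: "proper_fun \<Psi>\<^sub>2" "lsc_fun \<Psi>\<^sub>2" "convex_fun \<Psi>\<^sub>2"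
    and Psi_min: "has_minimum \<Psi>\<^sub>1 0" "has_minimum \<Psi>\<^sub>2 0"
    and C_def: "C = argmin_set \<Psi>\<^sub>1 \<inter> argmin_set \<Psi>\<^sub>2"
    and C_nonempty: "C \<noteq> {}"
    and lam_pos: "\<And>n. n \<ge> 1 \<Longrightarrow> lam n > 0"
    and beta_pos: "\<And>n. n \<ge> 1 \<Longrightarrow> beta n > 0"
    and T_def: "T = (\<lambda>x. A x + {gPhi x} + normal_cone C x)"
    and T_maximal: "maximal_monotone T"
    and S_def: "S = inv_op T 0"
    and S_nonempty: "S \<noteq> {}"
    and Phi_Lipschitz: "L_Phi-lipschitz_on UNIV gPhi"
    and Psi1_Lipschitz: "L_Psi1-lipschitz_on UNIV gPsi1"
    and conj_sum: "\<And>z. z \<in> (\<Union>x. normal_cone C x) \<Longrightarrow>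
      (\<Sum>n. ereal (lam (Suc n) * beta (Suc n)) *
        (fenchel_conjugate (\<lambda>y. ereal (\<Psi>\<^sub>1 y) + \<Psi>\<^sub>2 y) (z /\<^sub>R beta (Suc n))
          - support_fun C (z /\<^sub>R beta (Suc n)))) < \<infinity>"
    and lam_sum: "filterlim (\<lambda>N. \<Sum>n=1..N. lam n) at_top sequentially"
    and lam_sq_sum: "summable (\<lambda>n. L_Phi * (lam (Suc n))\<^sup>2)"
    and lam_beta: "limsup (\<lambda>n. ereal (L_Psi1 * lam n * beta n)) < 2"
    and strong: "strongly_monotone A \<or> strongly_monotone (\<lambda>x. {gPhi x})"
  shows "\<exists>u. S = {u} \<and>
    (\<forall>x. sfbp_sequence A gPhi gPsi1 \<Psi>\<^sub>2 lam beta x \<longrightarrow> x \<longlonglongrightarrow> u)"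
proof -
  have monoA: "monotone_op A" using A by (simp add: maximal_monotone_def)
  obtain \<alpha> where \<alpha>: "\<alpha> > 0"
    and strong_ineq: "\<And>x y u a v. a \<in> A y \<Longrightarrow> v \<in> A u \<Longrightarrow>
       inner (gPhi x - gPhi u) (y - u) + inner (a - v) (y - u)
         \<ge> \<alpha> * min ((norm (x - u))\<^sup>2) ((norm (y - u))\<^sup>2) - L_Phi / 2 * (norm (y - x))\<^sup>2"
    using strong_monotonicity_forward_backward[OF monoA Phi_convex Phi_grad Phi_Lipschitz strong]
    by blast
  have solution: "\<exists>v\<in>A u. \<exists>p\<in>normal_cone C u. v + gPhi u + p = 0" if "u \<in> S" for u
    using that unfolding S_def inv_op_def T_def
    by (fastforce elim!: set_plus_elim)
  have C_mem: "u \<in> C" if "p \<in> normal_cone C u" for p u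
    using that by (auto simp: normal_cone_def split: if_splits)

  obtain u where uS: "u \<in> S" using S_nonempty by blast
  obtain v p where v: "v \<in> A u" and p: "p \<in> normal_cone C u" and opt: "v + gPhi u + p = 0"
    using solution[OF uS] by blast
  have uC: "u \<in> C" by (rule C_mem[OF p])

  have "y = u" if y: "y \<in> S" for y
  proof -
    obtain a q where a: "a \<in> A y" and q: "q \<in> normal_cone C y" and opt': "a + gPhi y + q = 0"
      using solution[OF y] by blast
    have "inner p (y - u) \<le> 0"
      using p C_mem[OF q] by (auto simp: normal_cone_def split: if_splits)
    moreover have "inner q (u - y) \<le> 0"
      using q uC by (auto simp: normal_cone_def split: if_splits)
    moreover have
      "(gPhi y - gPhi u) + (a - v) = (a + gPhi y + q) - (v + gPhi u + p) + (p - q)" by simp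
    then have "(gPhi y - gPhi u) + (a - v) = p - q" by (simp add: opt opt')
    then have "inner (gPhi y - gPhi u) (y - u) + inner (a - v) (y - u) = inner (p - q) (y - u)"
      by (metis inner_add_left)
    ultimately have "\<alpha> * (norm (y - u))\<^sup>2 \<le> 0"
      using strong_ineq[OF a v, of y] by (simp add: inner_diff_left inner_diff_right)
    then show "y = u" using \<alpha> by (simp add: mult_le_0_iff)
  qed
  then have S_eq: "S = {u}" using uS by blast

  have Psi1_u: "\<Psi>\<^sub>1 u = 0" and Psi2_u: "\<Psi>\<^sub>2 u = 0"
    using uC Psi_min by (auto simp: C_def intro: argmin_setD_minimum)
  have Psi1_nonneg: "\<Psi>\<^sub>1 y \<ge> 0" and Psi2_nonneg: "\<Psi>\<^sub>2 y \<ge> 0" for y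
    using Psi_min by (auto simp: has_minimum_def)
  have L: "L_Phi \<ge> 0" "L_Psi1 \<ge> 0"
    using Phi_Lipschitz Psi1_Lipschitz by (auto intro: lipschitz_on_nonneg)

  obtain c where c: "limsup (\<lambda>n. ereal (L_Psi1 * lam n * beta n)) < ereal c" "c < 2"
    using ereal_dense2[OF lam_beta] by auto
  \<comment> \<open>With this choice the coefficient of the penalty gradient is at most
    \<open>(1 + \<eta>) c / 2 \<le> c/2 + \<eta> \<le> 1 - \<eta>\<close>, which leaves \<open>\<eta>\<close> for the term with \<open>L\<^sub>\<Phi> \<lambda>\<^sub>n\<close>.\<close>
  define \<eta> where "\<eta> = min 1 ((2 - c) / 4)"
  have \<eta>: "\<eta> > 0" "\<eta> \<le> 1" "\<eta> \<le> (2 - c) / 4"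
    using c(2) by (simp_all add: \<eta>_def del: min_le_iff_disj le_divide_eq_numeral1)
  \<comment> \<open>Working with \<open>L\<^sub>\<Phi> \<lambda>\<^sub>n\<close> instead of \<open>\<lambda>\<^sub>n\<close> includes the case \<open>L\<^sub>\<Phi> = 0\<close>, where the step sizes
    need not tend to zero.\<close>
  have "(\<lambda>n. L_Phi * (L_Phi * (lam (Suc n))\<^sup>2)) \<longlonglongrightarrow> 0"
    by (rule tendsto_mult_right_zero[OF summable_LIMSEQ_zero[OF lam_sq_sum]])
  moreover have "L_Phi * (L_Phi * (lam (Suc n))\<^sup>2) = (L_Phi * lam (Suc n))\<^sup>2" for n
    by (simp add: power2_eq_square)
  ultimately have "(\<lambda>n. (L_Phi * lam (Suc n))\<^sup>2) \<longlonglongrightarrow> 0"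
    by (simp only:)
  then have "(\<lambda>n. L_Phi * lam (Suc n)) \<longlonglongrightarrow> 0"
    by (subst (asm) power_tendsto_0_iff) simp_all
  then have "\<forall>\<^sub>F n in sequentially. L_Phi * lam (Suc n) < \<eta>"
    using \<eta>(1) by (rule order_tendstoD)
  moreover have "\<forall>\<^sub>F n in sequentially. L_Psi1 * lam (Suc n) * beta (Suc n) < c"
    using Limsup_lessD[OF c(1)]
    by (subst eventually_sequentially_Suc[where P = "\<lambda>n. L_Psi1 * lam n * beta n < c"]) simp
  ultimately have "\<forall>\<^sub>F n in sequentially.
      (1 + \<eta>) / 2 * (L_Psi1 * lam (Suc n) * beta (Suc n)) + L_Phi * lam (Suc n) \<le> 1"
  proof eventually_elim
    case (elim n)
    have "L_Psi1 * lam (Suc n) * beta (Suc n) \<ge> 0"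
      using L lam_pos[of "Suc n"] beta_pos[of "Suc n"] by (intro mult_nonneg_nonneg) auto
    then have "c \<ge> 0" using elim by linarith
    have "(1 + \<eta>) / 2 * (L_Psi1 * lam (Suc n) * beta (Suc n)) \<le> (1 + \<eta>) / 2 * c"
      using \<eta> elim by (intro mult_left_mono) auto
    also have "\<dots> = c / 2 + \<eta> * (c / 2)" by (simp add: field_simps)
    also have "\<dots> \<le> c / 2 + \<eta> * 1"
      using \<eta> c(2) by (intro add_left_mono mult_left_mono) auto
    also have "\<dots> \<le> 1 - \<eta>" using \<eta>(3) by simp
    finally show ?case using elim by linarith
  qed
  then obtain N where N: "\<And>n. n \<ge> N \<Longrightarrow>
      (1 + \<eta>) / 2 * (L_Psi1 * lam (Suc n) * beta (Suc n)) + L_Phi * lam (Suc n) \<le> 1"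
    by (auto simp: eventually_sequentially)

  have cone: "p /\<^sub>R \<eta> \<in> normal_cone C u"
    using \<eta>(1) by (intro normal_cone_scaleR p) simp
  obtain e where e: "summable e" "\<And>n. e n \<ge> 0"
    and e_bound: "\<And>n y r. ereal (\<Psi>\<^sub>1 y) + \<Psi>\<^sub>2 y = ereal r \<Longrightarrow>
      lam (Suc n) * beta (Suc n) * (inner (p /\<^sub>R \<eta> /\<^sub>R beta (Suc n)) (y - u) - r) \<le> e n"
  proof (rule conjugate_gap_errors[OF cone])
    show "(\<Sum>n. ereal (lam (Suc n) * beta (Suc n)) *
        (fenchel_conjugate (\<lambda>y. ereal (\<Psi>\<^sub>1 y) + \<Psi>\<^sub>2 y) (p /\<^sub>R \<eta> /\<^sub>R beta (Suc n))
          - support_fun C (p /\<^sub>R \<eta> /\<^sub>R beta (Suc n)))) < \<infinity>"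
      using cone by (intro conj_sum) blast
  qed (use lam_pos beta_pos Psi1_u Psi2_u in \<open>auto simp: zero_ereal_def\<close>)

  have "x \<longlonglongrightarrow> u" if x: "sfbp_sequence A gPhi gPsi1 \<Psi>\<^sub>2 lam beta x" for x
  proof -
    define m where "m n = min ((norm (x n - u))\<^sup>2) ((norm (x (Suc n) - u))\<^sup>2)" for n
    have step: "(norm (x (Suc (Suc n)) - u))\<^sup>2 + 2 * \<alpha> * (lam (Suc n) * m (Suc n))
        \<le> (norm (x (Suc n) - u))\<^sup>2 + 2 * \<eta> * e n" if n: "n \<ge> N" for n
    proof -
      let ?x = "x (Suc n)" and ?y = "x (Suc (Suc n))"
      obtain a s where a: "a \<in> A ?y" and s: "s \<in> subdifferential \<Psi>\<^sub>2 ?y"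
        and as: "(?x - ?y) /\<^sub>R lam (Suc n) - gPhi ?x - beta (Suc n) *\<^sub>R gPsi1 ?x
          = a + beta (Suc n) *\<^sub>R s"
      proof -
        have "(?x - ?y) /\<^sub>R lam (Suc n) - gPhi ?x - beta (Suc n) *\<^sub>R gPsi1 ?x
            \<in> A ?y + scaleR (beta (Suc n)) ` subdifferential \<Psi>\<^sub>2 ?y"
          using x by (simp add: sfbp_sequence_iff[OF lam_pos])
        then show thesis by (elim set_plus_elim imageE) (auto intro: that)
      qed
      obtain r where r: "\<Psi>\<^sub>2 ?y = ereal r" "r \<ge> 0" "inner s (?y - u) \<ge> r"
        using subgradient_at_zero_minimum[OF s Psi2_u Psi2_nonneg] by blast
      have "inner s (?y - u) \<ge> \<eta> * r"
        using r \<eta> mult_right_mono[of \<eta> 1 r] by simp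
      note energy_decrease[OF as opt _ _ \<eta>(1) strong_ineq[OF a v]
          penalty_forward_step[OF Psi1_convex Psi1_grad Psi1_Lipschitz Psi1_u Psi1_nonneg] this
          N[OF n]]
      then have "(norm (?y - u))\<^sup>2 + 2 * \<alpha> * (lam (Suc n) * m (Suc n))
          \<le> (norm (?x - u))\<^sup>2 + 2 * \<eta> * (lam (Suc n) * beta (Suc n) *
            (inner (p /\<^sub>R \<eta> /\<^sub>R beta (Suc n)) (?y - u) - (\<Psi>\<^sub>1 ?y + r)))"
        using \<eta> lam_pos[of "Suc n"] beta_pos[of "Suc n"] by (simp add: m_def)
      also have "\<dots> \<le> (norm (?x - u))\<^sup>2 + 2 * \<eta> * e n"
        using \<eta>(1) r(1) by (intro add_left_mono mult_left_mono e_bound) auto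
      finally show ?thesis .
    qed
    let ?d = "\<lambda>k. (norm (x (Suc (k + N)) - u))\<^sup>2"
      and ?m = "\<lambda>k. m (Suc (k + N))" and ?w = "\<lambda>k. lam (Suc (k + N))"
    have m_nonneg: "m n \<ge> 0" for n by (simp add: m_def)
    have w_nonneg: "?w k \<ge> 0" for k using lam_pos[of "Suc (k + N)"] by simp
    have e_sum: "summable (\<lambda>k. 2 * \<eta> * e (k + N))"
      using e(1) by (intro summable_mult) (subst summable_iff_shift)
    have c_nonneg: "2 * \<alpha> * (?w k * ?m k) \<ge> 0" and e_nonneg: "2 * \<eta> * e (k + N) \<ge> 0" for k
      using \<alpha> \<eta>(1) e(2) m_nonneg w_nonneg by (simp_all add: mult_nonneg_nonneg)
    have d_step: "?d (Suc k) + 2 * \<alpha> * (?w k * ?m k) \<le> ?d k + 2 * \<eta> * e (k + N)" for k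
      using step[of "k + N"] by simp
    note fejer = quasi_fejer_convergent_summable[of ?d, OF _ c_nonneg e_nonneg e_sum d_step]
    have sum: "summable (\<lambda>k. 2 * \<alpha> * (?w k * ?m k))"
      by (rule fejer(2)) simp
    have "convergent ?d"
      by (rule fejer(1)) simp
    then obtain l where l: "?d \<longlonglongrightarrow> l" by (auto simp: convergent_def)
    have "(\<lambda>k. ?d (Suc k)) \<longlonglongrightarrow> l" using l by (rule LIMSEQ_Suc)
    with l have "(\<lambda>k. min (?d k) (?d (Suc k))) \<longlonglongrightarrow> min l l" by (rule tendsto_min)
    then have m_lim: "?m \<longlonglongrightarrow> l" by (simp add: m_def)
    have "summable (\<lambda>k. ?w k * ?m k)"
      using summable_mult[OF sum, of "1 / (2 * \<alpha>)"] \<alpha> by simp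
    moreover have "\<not> summable ?w"
    proof
      assume "summable ?w"
      then have "summable (\<lambda>n. lam (Suc n))"
        using summable_iff_shift[of "\<lambda>n. lam (Suc n)" N] by simp
      then have "(\<lambda>n. \<Sum>k<n. lam (Suc k)) \<longlonglongrightarrow> (\<Sum>k. lam (Suc k))"
        by (rule summable_LIMSEQ)
      moreover have "filterlim (\<lambda>n. \<Sum>k<n. lam (Suc k)) at_top sequentially"
        using lam_sum by (simp add: sum.atLeast1_atMost_eq)
      ultimately show False
        using not_tendsto_and_filterlim_at_infinity[OF sequentially_bot]
          filterlim_at_top_imp_at_infinity by blast
    qed
    moreover have "l \<ge> 0"
      using l by (rule LIMSEQ_le_const) simp
    ultimately have "l = 0"
      by (intro limit_zero_if_weighted_summable[OF w_nonneg _ _ m_lim])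
    with l have "?d \<longlonglongrightarrow> 0" by simp
    then have "(\<lambda>k. norm (x (Suc (k + N)) - u)) \<longlonglongrightarrow> 0"
      by (subst (asm) power_tendsto_0_iff) simp_all
    then have "(\<lambda>k. x (Suc (k + N))) \<longlonglongrightarrow> u"
      by (simp only: tendsto_norm_zero_iff LIM_zero_iff)
    then have "(\<lambda>k. x (k + Suc N)) \<longlonglongrightarrow> u" by simp
    then show "x \<longlonglongrightarrow> u" by (rule LIMSEQ_offset)
  qed
  with S_eq show ?thesis by blast
qed

end
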